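(* Let $f, g$ be recursive permutations of $\mathbb{N}$ whose cycle equivalences $\Pi := \operatorname{Part} f$ and $\Gamma := \operatorname{Part} g$ are decidable, i.e. $f, g \in \operatorname{Perm}$. Then $f$ and $g$ are effectively conjugate if and only if $\Pi$ and $\Gamma$ are isomorphic: \[ \forall f, g \in \operatorname{Perm}:\quad f \sim g \iff \operatorname{Part} f \cong \operatorname{Part} g . \] Moreover, if a decider for one of the two equivalences is known, a recursive permutation $h$ with $f = h^{-1} g h$ can be computed uniformly effectively from a $(\Pi,\Gamma)$-isomorphism, and vice versa.
   Context: $\mathcal{G}$ denotes the group of recursive (total computable, bijective) permutations of $\mathbb{N}$. For a permutation $f$, $[x]_f = \{f^k(x) : k \in \mathbb{Z}\}$ is the cycle (orbit) of $x$, $x \equiv_f x'$ means $x' \in [x]_f$, and $\operatorname{Part} f = \{[x]_f : x \in \mathbb{N}\}$ is the associated partition/equivalence relation. An equivalence relation $\Pi$ on $\mathbb{N}$ is decidable if there is a total recursive $\pi$ with $\pi(x,x') = $ true iff $x \Pi x'$ (such $\pi$ is a decider). $\operatorname{Perm}$ is the set of $f \in \mathcal{G}$ with $\operatorname{Part} f$ decidable. Two permutations $f,g$ are effectively conjugate, written $f \sim g$, if there is $h \in \mathcal{G}$ with $f = h^{-1} g h$. For equivalences $\Pi, \Gamma$ on $\mathbb{N}$, a $(\Pi,\Gamma)$-isomorphism is a recursive permutation $\theta$ with $x \Pi y \iff \theta(x) \Gamma \theta(y)$ for all $x,y$; $\Pi \cong \Gamma$ means such $\theta$ exists. *)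

theory Defs
  imports Main "HOL-Library.Nat_Bijection"
begin

section \<open>Recursive functions\<close>

text \<open>
  Programs for the partial recursive functions. The arity is not part of the syntax: a program
  denotes a partial function on argument lists, and its restriction to lists of length n is the
  n-ary partial recursive function it computes.
\<close>

datatype recf =
    Zero
  | Succ
  | Proj nat
  | Comp recf "recf list"
  | PrimRec recf recf
  | Mu recf

inductive computes :: "recf \<Rightarrow> nat list \<Rightarrow> nat \<Rightarrow> bool" where
  Zero: "computes Zero xs 0"
| Succ: "computes Succ [x] (Suc x)"
| Proj: "i < length xs \<Longrightarrow> computes (Proj i) xs (xs ! i)"
| Comp: "list_all2 (\<lambda>g y. computes g xs y) gs ys \<Longrightarrow> computes f ys z \<Longrightarrow> computes (Comp f gs) xs z"
| PrimRec_0: "computes f xs y \<Longrightarrow> computes (PrimRec f g) (0 # xs) y"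
| PrimRec_Suc: "computes (PrimRec f g) (n # xs) r \<Longrightarrow> computes g (n # r # xs) y
    \<Longrightarrow> computes (PrimRec f g) (Suc n # xs) y"
| Mu: "computes f (n # xs) 0 \<Longrightarrow> (\<forall>m<n. \<exists>y. computes f (m # xs) (Suc y)) \<Longrightarrow> computes (Mu f) xs n"

lemma computes_functional: "computes p xs y \<Longrightarrow> computes p xs z \<Longrightarrow> y = z"
proof (induction arbitrary: z rule: computes.induct)
  case (Comp xs gs ys f w)
  from Comp.prems obtain ys' where ys': "list_all2 (\<lambda>g y. computes g xs y) gs ys'" "computes f ys' z"
    by (cases rule: computes.cases) auto
  have "ys = ys'"
    using Comp.IH(1) ys'(1) by (auto simp: list_all2_conv_all_nth intro!: nth_equalityI)
  then show ?case using Comp.IH ys' by blast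
next
  case (PrimRec_Suc f g n xs r y)
  from PrimRec_Suc.prems show ?case
    by (cases rule: computes.cases) (use PrimRec_Suc.IH in blast)
next
  case (Mu f n xs)
  from Mu.prems have z: "computes f (z # xs) 0" "\<forall>m<z. \<exists>y. computes f (m # xs) (Suc y)"
    by (auto elim: computes.cases)
  have "\<not> z < n" using Mu.IH z(1) by fastforce
  moreover have "\<not> n < z" using Mu.IH z(2) by fastforce
  ultimately show ?case by simp
next
  case (PrimRec_0 f xs y g)
  from PrimRec_0.prems show ?case
    by (cases rule: computes.cases) (use PrimRec_0.IH in blast)
qed (erule computes.cases; simp)+

definition recursive :: "nat \<Rightarrow> (nat list \<Rightarrow> nat) \<Rightarrow> bool" where
  "recursive n F \<longleftrightarrow> (\<exists>p. \<forall>xs. length xs = n \<longrightarrow> computes p xs (F xs))"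

definition realizes :: "recf \<Rightarrow> (nat \<Rightarrow> nat) \<Rightarrow> bool" where
  "realizes p f \<longleftrightarrow> (\<forall>x. computes p [x] (f x))"

text \<open>The truth values are represented by 1 and 0.\<close>

definition decides :: "recf \<Rightarrow> (nat \<times> nat) set \<Rightarrow> bool" where
  "decides p r \<longleftrightarrow> (\<forall>x y. computes p [x, y] (of_bool ((x, y) \<in> r)))"

definition decidable :: "(nat \<times> nat) set \<Rightarrow> bool" where
  "decidable r \<longleftrightarrow> (\<exists>p. decides p r)"

text \<open>A Goedel numbering of programs, so that algorithms can take programs as input and output.\<close>

primrec goedel :: "recf \<Rightarrow> nat" where
  "goedel Zero = prod_encode (0, 0)"
| "goedel Succ = prod_encode (1, 0)"
| "goedel (Proj i) = prod_encode (2, i)"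
| "goedel (Comp f gs) = prod_encode (3, prod_encode (goedel f, list_encode (map goedel gs)))"
| "goedel (PrimRec f g) = prod_encode (4, prod_encode (goedel f, goedel g))"
| "goedel (Mu f) = prod_encode (5, goedel f)"

lemma goedel_eq_iff: "goedel p = goedel q \<longleftrightarrow> p = q"
proof
  show "goedel p = goedel q \<Longrightarrow> p = q"
  proof (induction p arbitrary: q)
    case (Comp f gs)
    from Comp.prems obtain f' gs' where q: "q = Comp f' gs'" and f: "goedel f = goedel f'"
      and gs: "map goedel gs = map goedel gs'"
      by (cases q) (auto simp: list_encode_eq)
    have "gs = gs'"
      by (rule list.inj_map_strong[OF _ gs]) (rule Comp.IH(2))
    then show ?case using q f Comp.IH(1) by simp
  next
    case Zero then show ?case by (cases q) auto
  next
    case Succ then show ?case by (cases q) auto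
  next
    case (Proj i) then show ?case by (cases q) auto
  next
    case (PrimRec f g) then show ?case by (cases q) auto
  next
    case (Mu f) then show ?case by (cases q) auto
  qed
qed simp

section \<open>Recursive permutations and their cycles\<close>

definition rec_perms :: "(nat \<Rightarrow> nat) set" where
  "rec_perms = {f. bij f \<and> (\<exists>p. realizes p f)}"

definition perm_power :: "(nat \<Rightarrow> nat) \<Rightarrow> int \<Rightarrow> nat \<Rightarrow> nat" where
  "perm_power f k = (if k \<ge> 0 then f ^^ nat k else inv f ^^ nat (- k))"

definition cycle :: "(nat \<Rightarrow> nat) \<Rightarrow> nat \<Rightarrow> nat set" where
  "cycle f x = {perm_power f k x |k. True}"

text \<open>The partition of the natural numbers into cycles, given as an equivalence relation.\<close>

definition Part :: "(nat \<Rightarrow> nat) \<Rightarrow> (nat \<times> nat) set" where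
  "Part f = {(x, x'). x' \<in> cycle f x}"

definition Perm :: "(nat \<Rightarrow> nat) set" where
  "Perm = {f \<in> rec_perms. decidable (Part f)}"

definition conjugates :: "(nat \<Rightarrow> nat) \<Rightarrow> (nat \<Rightarrow> nat) \<Rightarrow> (nat \<Rightarrow> nat) \<Rightarrow> bool" where
  "conjugates h f g \<longleftrightarrow> h \<in> rec_perms \<and> f = inv h \<circ> g \<circ> h"

definition effectively_conjugate :: "(nat \<Rightarrow> nat) \<Rightarrow> (nat \<Rightarrow> nat) \<Rightarrow> bool" where
  "effectively_conjugate f g \<longleftrightarrow> (\<exists>h. conjugates h f g)"

definition isomorphism :: "(nat \<Rightarrow> nat) \<Rightarrow> (nat \<times> nat) set \<Rightarrow> (nat \<times> nat) set \<Rightarrow> bool" where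
  "isomorphism \<theta> \<Pi> \<Gamma> \<longleftrightarrow>
    \<theta> \<in> rec_perms \<and> (\<forall>x y. (x, y) \<in> \<Pi> \<longleftrightarrow> (\<theta> x, \<theta> y) \<in> \<Gamma>)"

definition isomorphic :: "(nat \<times> nat) set \<Rightarrow> (nat \<times> nat) set \<Rightarrow> bool" where
  "isomorphic \<Pi> \<Gamma> \<longleftrightarrow> (\<exists>\<theta>. isomorphism \<theta> \<Pi> \<Gamma>)"

section \<open>Uniform effectiveness\<close>

text \<open>
  A witness satisfying \<^term>\<open>B f g\<close> can be computed from a witness satisfying \<^term>\<open>A f g\<close>,
  given a decider for the equivalence \<^term>\<open>\<Delta> f g\<close>: a single recursive function maps programs
  for f, g, the decider and the given witness to a program for the wanted witness. It does not
  depend on f and g.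
\<close>

definition uniformly_computable_from ::
  "((nat \<Rightarrow> nat) \<Rightarrow> (nat \<Rightarrow> nat) \<Rightarrow> (nat \<times> nat) set) \<Rightarrow>
   ((nat \<Rightarrow> nat) \<Rightarrow> (nat \<Rightarrow> nat) \<Rightarrow> (nat \<Rightarrow> nat) \<Rightarrow> bool) \<Rightarrow>
   ((nat \<Rightarrow> nat) \<Rightarrow> (nat \<Rightarrow> nat) \<Rightarrow> (nat \<Rightarrow> nat) \<Rightarrow> bool) \<Rightarrow> bool" where
  "uniformly_computable_from \<Delta> A B \<longleftrightarrow>
    (\<exists>T. recursive 4 T \<and>
      (\<forall>f\<in>Perm. \<forall>g\<in>Perm. \<forall>a. A f g a \<longrightarrow>
        (\<forall>p q d s. realizes p f \<and> realizes q g \<and> decides d (\<Delta> f g) \<and> realizes s a \<longrightarrow>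
          (\<exists>b t. B f g b \<and> realizes t b \<and>
             T [goedel p, goedel q, goedel d, goedel s] = goedel t))))"

end

theory Submission
  imports Defs
begin

text \<open>
  Every point is uniquely of the form \<open>f\<^sup>k x\<^sub>0\<close>, where \<open>x\<^sub>0\<close> is the least element of its
  cycle and the integer \<open>k\<close> is unique modulo the length of the cycle (unique if the cycle is
  infinite). An isomorphism \<open>\<theta>\<close> maps cycles of \<open>f\<close> bijectively to cycles of \<open>g\<close>, so
  corresponding cycles have the same length and \<open>f\<^sup>k x\<^sub>0 \<mapsto> g\<^sup>k (\<theta> x\<^sub>0)\<close> is a well-defined
  conjugation. It is computable: the decider finds \<open>x\<^sub>0\<close>, and an unbounded search finds \<open>k\<close>.
  A decider for \<open>\<Gamma>\<close> can be pulled back along \<open>\<theta>\<close> to one for \<open>\<Pi>\<close>. Conversely, a conjugation is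
  itself an isomorphism.

  Uniformity needs no universal program: the program of the conjugation is a fixed syntactic
  context in the given programs, so its code is a pairing polynomial in theirs.
\<close>

section \<open>Basic programs\<close>

lemma computes_Proj: "i < length xs \<Longrightarrow> xs ! i = y \<Longrightarrow> computes (Proj i) xs y"
  using computes.Proj by blast

lemma computes_Comp1:
  "computes g xs a \<Longrightarrow> computes f [a] z \<Longrightarrow> computes (Comp f [g]) xs z"
  by (rule computes.Comp[of _ _ "[a]"]) auto

lemma computes_Comp2:
  "computes g xs a \<Longrightarrow> computes g' xs b \<Longrightarrow> computes f [a, b] z \<Longrightarrow> computes (Comp f [g, g']) xs z"
  by (rule computes.Comp[of _ _ "[a, b]"]) auto

lemma computes_Comp3:
  "computes g xs a \<Longrightarrow> computes g' xs b \<Longrightarrow> computes g'' xs c \<Longrightarrow> computes f [a, b, c] z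
    \<Longrightarrow> computes (Comp f [g, g', g'']) xs z"
  by (rule computes.Comp[of _ _ "[a, b, c]"]) auto

lemmas computes_Comps = computes_Comp1 computes_Comp2 computes_Comp3

lemma computes_PrimRec:
  assumes "computes f xs (r 0)" "\<And>k. computes g (k # r k # xs) (r (Suc k))"
  shows "computes (PrimRec f g) (n # xs) (r n)"
  by (induction n) (use assms in \<open>auto intro: computes.intros\<close>)

text \<open>The body is total in the search variable, so every value below the least zero is defined
  and is a successor, which is what \<open>Mu\<close> demands.\<close>

lemma computes_Mu_Least:
  assumes "\<And>n. computes f (n # xs) (F n)" "F k = 0"
  shows "computes (Mu f) xs (LEAST n. F n = 0)"
proof (rule computes.Mu)
  show "computes f ((LEAST n. F n = 0) # xs) 0"
    using assms(1)[of "LEAST n. F n = 0"] LeastI[of "\<lambda>n. F n = 0", OF assms(2)] by simp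
  show "\<forall>m<LEAST n. F n = 0. \<exists>y. computes f (m # xs) (Suc y)"
    using assms(1) not_less_Least by (metis not0_implies_Suc)
qed

text \<open>The step of \<open>PrimRec\<close> receives the counter ahead of the previous value;
  returning the counter gives the predecessor.\<close>

definition pred_prog :: recf where
  "pred_prog = PrimRec Zero (Proj 0)"

definition monus_prog :: recf where
  "monus_prog = PrimRec (Proj 0) (Comp pred_prog [Proj 1])"

definition add_prog :: recf where
  "add_prog = PrimRec (Proj 0) (Comp Succ [Proj 1])"

definition mult_prog :: recf where
  "mult_prog = PrimRec Zero (Comp add_prog [Proj 1, Proj 2])"

text \<open>Absolute difference through truncated subtraction: an equality test whose success value
  is 0, as \<open>Mu\<close> expects.\<close>

definition dist_prog :: recf where
  "dist_prog = Comp add_prog [Comp monus_prog [Proj 0, Proj 1], Comp monus_prog [Proj 1, Proj 0]]"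

text \<open>The step sees the counter, the previous value and the two branches, so
  \<open>Proj 3\<close> is the second branch.\<close>

definition if_zero_prog :: recf where
  "if_zero_prog = PrimRec (Proj 0) (Proj 3)"

definition triangle_prog :: recf where
  "triangle_prog = PrimRec Zero (Comp add_prog [Proj 1, Comp Succ [Proj 0]])"

text \<open>Cantor's pairing in the form underlying \<open>prod_encode\<close>, so that programs can
  assemble Goedel numbers.\<close>

definition pair_prog :: recf where
  "pair_prog = Comp add_prog [Comp triangle_prog [Comp add_prog [Proj 0, Proj 1]], Proj 0]"

lemma computes_pred: "computes pred_prog [n] (n - 1)"
  unfolding pred_prog_def
  by (rule computes_PrimRec[where r = "\<lambda>n. n - 1"]) (auto intro: computes.Zero computes_Proj)

text \<open>The recursion is on the first argument, which is therefore the subtrahend.\<close>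

lemma computes_monus: "computes monus_prog [m, n] (n - m)"
  unfolding monus_prog_def
proof (rule computes_PrimRec[where r = "\<lambda>m. n - m"])
  show "computes (Comp pred_prog [Proj 1]) [k, n - k, n] (n - Suc k)" for k
    using computes_pred[of "n - k"] by (auto intro!: computes_Comps computes_Proj)
qed (auto intro: computes_Proj)

lemma computes_add: "computes add_prog [m, n] (m + n)"
  unfolding add_prog_def
  by (rule computes_PrimRec[where r = "\<lambda>m. m + n"])
    (auto intro!: computes_Comps computes_Proj computes.Succ)

lemma computes_mult: "computes mult_prog [m, n] (m * n)"
  unfolding mult_prog_def
proof (rule computes_PrimRec[where r = "\<lambda>m. m * n"])
  show "computes (Comp add_prog [Proj 1, Proj 2]) [k, k * n, n] (Suc k * n)" for k
    using computes_add[of "k * n" n] by (auto intro!: computes_Comps computes_Proj simp: add.commute)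
qed (auto intro: computes.Zero)

lemma computes_dist: "computes dist_prog [m, n] ((n - m) + (m - n))"
  unfolding dist_prog_def
  by (rule computes_Comps computes_add computes_monus computes_Proj | simp)+

lemma computes_if_zero: "computes if_zero_prog [c, a, b] (if c = 0 then a else b)"
  unfolding if_zero_prog_def
  by (rule computes_PrimRec[where r = "\<lambda>c. if c = 0 then a else b"])
    (auto intro!: computes_Proj)

lemma computes_triangle: "computes triangle_prog [n] (triangle n)"
  unfolding triangle_prog_def
proof (rule computes_PrimRec[where r = triangle])
  show "computes (Comp add_prog [Proj 1, Comp Succ [Proj 0]]) [k, triangle k] (triangle (Suc k))" for k
    unfolding triangle_Suc
    by (rule computes_Comps computes_add computes.Succ computes_Proj | simp)+
qed (auto intro: computes.Zero)

lemma computes_pair: "computes pair_prog [m, n] (prod_encode (m, n))"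
  unfolding pair_prog_def prod_encode_def split
  by (rule computes_Comps computes_add computes_triangle computes_Proj | simp)+

section \<open>Iterates and inverses as contexts around a program\<close>

definition iterate_prog :: "recf \<Rightarrow> recf" where
  "iterate_prog p = PrimRec (Proj 0) (Comp p [Proj 1])"

definition inverse_prog :: "recf \<Rightarrow> recf" where
  "inverse_prog p = Mu (Comp dist_prog [Comp p [Proj 0], Proj 1])"

lemma computes_iterate:
  assumes "realizes p f"
  shows "computes (iterate_prog p) [k, x] ((f ^^ k) x)"
  unfolding iterate_prog_def
  by (rule computes_PrimRec[where r = "\<lambda>k. (f ^^ k) x"])
    (use assms in \<open>auto simp: realizes_def intro!: computes_Comps computes_Proj\<close>)

text \<open>Surjectivity makes the search for a preimage halt; injectivity makes its result the only
  preimage.\<close>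

lemma realizes_inverse:
  assumes "realizes p f" "bij f"
  shows "realizes (inverse_prog p) (inv f)"
  unfolding realizes_def
proof
  fix y
  define F where "F = (\<lambda>x. (y - f x) + (f x - y))"
  have zero: "F x = 0 \<longleftrightarrow> x = inv f y" for x
    using \<open>bij f\<close> by (auto simp: F_def bij_inv_eq_iff)
  have "computes (Comp dist_prog [Comp p [Proj 0], Proj 1]) [x, y] (F x)" for x
    unfolding F_def using assms(1)
    by (auto simp: realizes_def intro!: computes_Comps computes_dist computes_Proj)
  then have "computes (inverse_prog p) [y] (LEAST x. F x = 0)"
    unfolding inverse_prog_def by (rule computes_Mu_Least) (simp add: zero)
  then show "computes (inverse_prog p) [y] (inv f y)"
    using Least_equality[of "\<lambda>x. x = inv f y" "inv f y"] by (simp add: zero)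
qed

section \<open>Computable transformations of programs\<close>

lemma recursive_nth: "i < n \<Longrightarrow> recursive n (\<lambda>xs. xs ! i)"
  unfolding recursive_def by (auto intro: computes_Proj)

lemma recursive_Suc:
  assumes "recursive n F"
  shows "recursive n (\<lambda>xs. Suc (F xs))"
proof -
  obtain p where "\<And>xs. length xs = n \<Longrightarrow> computes p xs (F xs)"
    using assms by (auto simp: recursive_def)
  then have "\<forall>xs. length xs = n \<longrightarrow> computes (Comp Succ [p]) xs (Suc (F xs))"
    by (auto intro!: computes_Comps computes.Succ)
  then show ?thesis unfolding recursive_def by blast
qed

lemma recursive_const: "recursive n (\<lambda>xs. c)"
proof (induction c)
  case 0
  then show ?case unfolding recursive_def using computes.Zero by blast
qed (rule recursive_Suc)

lemma recursive_prod_encode: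
  assumes "recursive n F" "recursive n G"
  shows "recursive n (\<lambda>xs. prod_encode (F xs, G xs))"
proof -
  obtain p q where "\<And>xs. length xs = n \<Longrightarrow> computes p xs (F xs)"
    "\<And>xs. length xs = n \<Longrightarrow> computes q xs (G xs)"
    using assms by (auto simp: recursive_def)
  then have "\<forall>xs. length xs = n \<longrightarrow> computes (Comp pair_prog [p, q]) xs (prod_encode (F xs, G xs))"
    by (auto intro!: computes_Comps computes_pair)
  then show ?thesis unfolding recursive_def by blast
qed

text \<open>\<open>T\<close> mirrors on codes what \<open>C\<close> does to syntax; its values on
  numbers that code no program are unconstrained.\<close>

definition computable_transformation :: "nat \<Rightarrow> (recf list \<Rightarrow> recf) \<Rightarrow> bool" where
  "computable_transformation n C \<longleftrightarrow>
    (\<exists>T. recursive n T \<and> (\<forall>ps. length ps = n \<longrightarrow> T (map goedel ps) = goedel (C ps)))"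

text \<open>Companion notion for the argument lists of \<open>Comp\<close>, which
  \<open>goedel\<close> codes by \<open>list_encode\<close>.\<close>

definition computable_list_transformation :: "nat \<Rightarrow> (recf list \<Rightarrow> recf list) \<Rightarrow> bool" where
  "computable_list_transformation n D \<longleftrightarrow>
    (\<exists>T. recursive n T \<and> (\<forall>ps. length ps = n \<longrightarrow> T (map goedel ps) = list_encode (map goedel (D ps))))"

lemma computable_transformation_const: "computable_transformation n (\<lambda>ps. p)"
  unfolding computable_transformation_def using recursive_const by blast

lemma computable_transformation_nth: "i < n \<Longrightarrow> computable_transformation n (\<lambda>ps. ps ! i)"
  unfolding computable_transformation_def
  by (intro exI[of _ "\<lambda>xs. xs ! i"]) (auto intro: recursive_nth)

lemma computable_transformation_Comp:
  assumes "computable_transformation n C" "computable_list_transformation n D"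
  shows "computable_transformation n (\<lambda>ps. Comp (C ps) (D ps))"
proof -
  obtain S T where "recursive n S" "\<And>ps. length ps = n \<Longrightarrow> S (map goedel ps) = goedel (C ps)"
    "recursive n T" "\<And>ps. length ps = n \<Longrightarrow> T (map goedel ps) = list_encode (map goedel (D ps))"
    using assms by (auto simp: computable_transformation_def computable_list_transformation_def)
  then show ?thesis unfolding computable_transformation_def
    \<comment> \<open>The constant 3 is the tag of \<open>Comp\<close> in \<open>goedel\<close>; 4
      and 5 in the next two lemmas are those of \<open>PrimRec\<close> and
      \<open>Mu\<close>.\<close>
    by (intro exI[of _ "\<lambda>xs. prod_encode (3, prod_encode (S xs, T xs))"])
      (auto intro!: recursive_prod_encode recursive_const)
qed

lemma computable_transformation_PrimRec:
  assumes "computable_transformation n C" "computable_transformation n D"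
  shows "computable_transformation n (\<lambda>ps. PrimRec (C ps) (D ps))"
proof -
  obtain S T where "recursive n S" "\<And>ps. length ps = n \<Longrightarrow> S (map goedel ps) = goedel (C ps)"
    "recursive n T" "\<And>ps. length ps = n \<Longrightarrow> T (map goedel ps) = goedel (D ps)"
    using assms by (auto simp: computable_transformation_def)
  then show ?thesis unfolding computable_transformation_def
    by (intro exI[of _ "\<lambda>xs. prod_encode (4, prod_encode (S xs, T xs))"])
      (auto intro!: recursive_prod_encode recursive_const)
qed

lemma computable_transformation_Mu:
  assumes "computable_transformation n C"
  shows "computable_transformation n (\<lambda>ps. Mu (C ps))"
proof -
  obtain S where "recursive n S" "\<And>ps. length ps = n \<Longrightarrow> S (map goedel ps) = goedel (C ps)"
    using assms by (auto simp: computable_transformation_def)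
  then show ?thesis unfolding computable_transformation_def
    by (intro exI[of _ "\<lambda>xs. prod_encode (5, S xs)"])
      (auto intro!: recursive_prod_encode recursive_const)
qed

lemma computable_list_transformation_Nil: "computable_list_transformation n (\<lambda>ps. [])"
  unfolding computable_list_transformation_def using recursive_const by fastforce

lemma computable_list_transformation_Cons:
  assumes "computable_transformation n C" "computable_list_transformation n D"
  shows "computable_list_transformation n (\<lambda>ps. C ps # D ps)"
proof -
  obtain S T where "recursive n S" "\<And>ps. length ps = n \<Longrightarrow> S (map goedel ps) = goedel (C ps)"
    "recursive n T" "\<And>ps. length ps = n \<Longrightarrow> T (map goedel ps) = list_encode (map goedel (D ps))"
    using assms by (auto simp: computable_transformation_def computable_list_transformation_def)
  then show ?thesis unfolding computable_list_transformation_def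
    \<comment> \<open>\<open>list_encode\<close> codes a nonempty list as the successor of the pair
      of head and coded tail.\<close>
    by (intro exI[of _ "\<lambda>xs. Suc (prod_encode (S xs, T xs))"])
      (auto intro!: recursive_prod_encode recursive_Suc)
qed

lemmas computable_transformation_intros =
  computable_transformation_const computable_transformation_nth
  computable_transformation_Comp computable_transformation_PrimRec computable_transformation_Mu
  computable_list_transformation_Nil computable_list_transformation_Cons

section \<open>Integer powers and cycles\<close>

lemma perm_power_0: "perm_power f 0 x = x"
  by (simp add: perm_power_def)

lemma perm_power_of_nat: "perm_power f (int k) = f ^^ k"
  by (simp add: perm_power_def)

lemma perm_power_minus_of_nat: "perm_power f (- int k) = inv f ^^ k"
  by (simp add: perm_power_def)

lemma perm_power_plus_1:
  assumes "bij f"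
  shows "perm_power f (k + 1) x = f (perm_power f k x)"
proof (cases "k \<ge> 0")
  case True
  then have "nat (k + 1) = Suc (nat k)" by simp
  with True show ?thesis by (simp add: perm_power_def)
next
  case False
  \<comment> \<open>Chosen so that \<open>k + 1\<close> is \<open>- n\<close> and \<open>k\<close>
    is one inverse step further, which \<open>f\<close> undoes.\<close>
  define n where "n = nat (- k - 1)"
  have k: "k = - int (Suc n)" using False by (simp add: n_def)
  have "perm_power f (k + 1) x = (inv f ^^ n) x"
    using perm_power_minus_of_nat[of f n] k by simp
  moreover have "perm_power f k x = inv f ((inv f ^^ n) x)"
    unfolding k perm_power_minus_of_nat by simp
  ultimately show ?thesis using assms by (simp add: bij_is_surj surj_f_inv_f)
qed

lemma perm_power_add:
  assumes "bij f"
  shows "perm_power f (j + k) x = perm_power f j (perm_power f k x)"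
proof (induction j rule: int_induct[where k = 0])
  case base
  then show ?case by (simp add: perm_power_0)
next
  case (step1 i)
  then show ?case
    using perm_power_plus_1[OF assms, of "i + k" x] perm_power_plus_1[OF assms, of i]
    by (simp add: algebra_simps)
next
  case (step2 i)
  \<comment> \<open>Going down, apply \<open>f\<close> to both sides to reach the case
    \<open>i\<close>, then cancel \<open>f\<close> by injectivity.\<close>
  have "f (perm_power f (i - 1 + k) x) = f (perm_power f (i - 1) (perm_power f k x))"
    using step2 perm_power_plus_1[OF assms, of "i - 1 + k" x] perm_power_plus_1[OF assms, of "i - 1"]
    by (simp add: algebra_simps)
  then show ?case using assms by (simp add: bij_is_inj inj_eq)
qed

lemma perm_power_uminus_cancel:
  "bij f \<Longrightarrow> perm_power f (- k) (perm_power f k x) = x"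
  using perm_power_add[of f "- k" k x] by (simp add: perm_power_0)

lemma perm_power_eq_iff:
  assumes "bij f"
  shows "perm_power f j x = perm_power f k x \<longleftrightarrow> perm_power f (j - k) x = x"
proof -
  have "perm_power f (j - k) x = perm_power f (- k) (perm_power f j x)"
    using perm_power_add[OF assms, of "- k" j x] by simp
  moreover have "perm_power f j x = perm_power f k (perm_power f (j - k) x)"
    using perm_power_add[OF assms, of k "j - k" x] by simp
  ultimately show ?thesis using perm_power_uminus_cancel[OF assms, of k x] by metis
qed

lemma in_cycle_iff: "y \<in> cycle f x \<longleftrightarrow> (\<exists>k. y = perm_power f k x)"
  by (auto simp: cycle_def)

lemma equiv_Part:
  assumes "bij f"
  shows "equiv UNIV (Part f)"
proof (rule equivI)
  show "refl (Part f)"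
    by (auto simp: refl_on_def Part_def in_cycle_iff intro: exI[of _ 0] perm_power_0[symmetric])
  show "sym (Part f)"
    by (auto simp: sym_def Part_def in_cycle_iff)
      (metis assms perm_power_uminus_cancel)
  show "trans (Part f)"
    by (auto simp: trans_def Part_def in_cycle_iff)
      (metis assms perm_power_add)
qed auto

text \<open>For an infinite cycle the convention that its cardinality is 0 gives the right answer:
  only the exponent 0 fixes the point.\<close>

lemma perm_power_fixes_iff:
  assumes "bij f"
  shows "perm_power f k x = x \<longleftrightarrow> int (card (cycle f x)) dvd k"
proof (cases "\<exists>n>0. perm_power f (int n) x = x")
  case False
  have fix_0: "j = 0" if j: "perm_power f j x = x" for j
  proof (rule ccontr)
    assume "j \<noteq> 0"
    have "perm_power f (- j) x = x"
      using perm_power_uminus_cancel[OF assms, of j x] j by simp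
    with j have "perm_power f (int (nat \<bar>j\<bar>)) x = x"
      by (cases "j \<ge> 0") auto
    moreover have "nat \<bar>j\<bar> > 0" using \<open>j \<noteq> 0\<close> by simp
    ultimately show False using False by blast
  qed
  \<comment> \<open>Equal powers would make their exponent difference fix \<open>x\<close>; hence
    the integers embed into the cycle and it is infinite.\<close>
  have "inj (\<lambda>k. perm_power f k x)"
  proof (rule injI)
    fix i j assume "perm_power f i x = perm_power f j x"
    then have "i - j = 0" by (intro fix_0) (simp add: perm_power_eq_iff[OF assms])
    then show "i = j" by simp
  qed
  moreover have "cycle f x = range (\<lambda>k. perm_power f k x)"
    by (auto simp: cycle_def)
  ultimately have "infinite (cycle f x)"
    by (simp add: finite_image_iff infinite_UNIV_int)
  with fix_0 show ?thesis by (auto simp: perm_power_0)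
next
  case True
  \<comment> \<open>The period of \<open>x\<close>, to be identified with the cardinality of its
    cycle.\<close>
  define m where "m = (LEAST n. 0 < n \<and> perm_power f (int n) x = x)"
  have m: "m > 0" "perm_power f (int m) x = x"
    using LeastI_ex[OF True] by (simp_all add: m_def)
  have min: "n = 0" if "n < m" "perm_power f (int n) x = x" for n
    using not_less_Least[OF that(1)[unfolded m_def]] that(2) by simp
  have mult: "perm_power f (int m * j) x = x" for j
  proof (induction j rule: int_induct[where k = 0])
    case (step1 i)
    then show ?case using perm_power_add[OF assms, of "int m" "int m * i" x] m
      by (simp add: algebra_simps)
  next
    case (step2 i)
    then show ?case using perm_power_add[OF assms, of "int m * (i - 1)" "int m" x] m
      by (simp add: algebra_simps)
  qed (simp add: perm_power_0)
  have mod: "perm_power f j x = perm_power f (j mod int m) x" for j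
    using perm_power_add[OF assms, of "j mod int m" "int m * (j div int m)" x] mult by simp
  have dvd: "perm_power f j x = x \<longleftrightarrow> int m dvd j" for j
  proof
    \<comment> \<open>The remainder of \<open>j\<close> modulo \<open>m\<close> also fixes
      \<open>x\<close> and is below \<open>m\<close>, so minimality of the period forces it to be
      0.\<close>
    assume "perm_power f j x = x"
    then have "perm_power f (j mod int m) x = x" by (simp only: mod[of j, symmetric])
    then have "perm_power f (int (nat (j mod int m))) x = x" using m by simp
    moreover have "nat (j mod int m) < m" using m by (simp add: nat_less_iff)
    ultimately have "nat (j mod int m) = 0" by (intro min)
    then have "j mod int m = 0" using m pos_mod_sign[of "int m" j] by linarith
    then show "int m dvd j" by (rule mod_0_imp_dvd)
  qed (auto simp: mult)
  \<comment> \<open>One period of exponents runs through the cycle without repetition.\<close>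
  have "bij_betw (\<lambda>k. perm_power f k x) {0..<int m} (cycle f x)"
  proof (rule bij_betw_imageI)
    show "inj_on (\<lambda>k. perm_power f k x) {0..<int m}"
    proof (rule inj_onI)
      fix i j assume ij: "i \<in> {0..<int m}" "j \<in> {0..<int m}" "perm_power f i x = perm_power f j x"
      then have "int m dvd i - j" by (simp only: perm_power_eq_iff[OF assms] dvd)
      then have "i mod int m = j mod int m" by (simp add: mod_eq_dvd_iff)
      with ij show "i = j" by simp
    qed
    show "(\<lambda>k. perm_power f k x) ` {0..<int m} = cycle f x"
    proof
      show "cycle f x \<subseteq> (\<lambda>k. perm_power f k x) ` {0..<int m}"
      proof
        fix y assume "y \<in> cycle f x"
        then obtain j where "y = perm_power f j x" by (auto simp: in_cycle_iff)
        then have "y = perm_power f (j mod int m) x" by (subst mod[symmetric])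
        then show "y \<in> (\<lambda>k. perm_power f k x) ` {0..<int m}" using m by auto
      qed
    qed (auto simp: in_cycle_iff)
  qed
  from bij_betw_same_card[OF this] have "card (cycle f x) = m" by simp
  with dvd show ?thesis by simp
qed

section \<open>Conjugation from an isomorphism\<close>

definition cycle_rep :: "(nat \<Rightarrow> nat) \<Rightarrow> nat \<Rightarrow> nat" where
  "cycle_rep f x = (LEAST y. (y, x) \<in> Part f)"

text \<open>The least absolute value of an exponent that leads from the representative to the point.\<close>

definition rep_exponent :: "(nat \<Rightarrow> nat) \<Rightarrow> nat \<Rightarrow> nat" where
  "rep_exponent f x =
    (LEAST k. (f ^^ k) (cycle_rep f x) = x \<or> (f ^^ k) x = cycle_rep f x)"

text \<open>The test recovers the sign that \<open>rep_exponent\<close> forgets: if it fails, the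
  exponent leading from \<open>x0\<close> to \<open>x\<close> is \<open>- k\<close>.\<close>

definition transfer :: "(nat \<Rightarrow> nat) \<Rightarrow> (nat \<Rightarrow> nat) \<Rightarrow> (nat \<Rightarrow> nat) \<Rightarrow> nat \<Rightarrow> nat" where
  "transfer f g \<theta> x =
    (let x0 = cycle_rep f x; k = rep_exponent f x in
      if (f ^^ k) x0 = x then (g ^^ k) (\<theta> x0) else (inv g ^^ k) (\<theta> x0))"

text \<open>Deciders answer 1 for true while \<open>Mu\<close> looks for 0, so the answer is
  subtracted from 1.\<close>

definition rep_prog :: "recf \<Rightarrow> recf" where
  "rep_prog d = Mu (Comp monus_prog [d, Comp Succ [Zero]])"

text \<open>A product vanishes iff a factor does, so multiplying the two equality tests expresses
  the disjunction in \<open>rep_exponent\<close>.\<close>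

definition exponent_prog :: "recf \<Rightarrow> recf \<Rightarrow> recf" where
  "exponent_prog p d = Mu (Comp mult_prog
    [Comp dist_prog [Comp (iterate_prog p) [Proj 0, Comp (rep_prog d) [Proj 1]], Proj 1],
     Comp dist_prog [iterate_prog p, Comp (rep_prog d) [Proj 1]]])"

definition transfer_prog :: "recf \<Rightarrow> recf \<Rightarrow> recf \<Rightarrow> recf \<Rightarrow> recf" where
  "transfer_prog p q d s = Comp if_zero_prog
    [Comp dist_prog [Comp (iterate_prog p) [exponent_prog p d, rep_prog d], Proj 0],
     Comp (iterate_prog q) [exponent_prog p d, Comp s [rep_prog d]],
     Comp (iterate_prog (inverse_prog q)) [exponent_prog p d, Comp s [rep_prog d]]]"

lemma cycle_rep_in_Part:
  assumes "bij f"
  shows "(cycle_rep f x, x) \<in> Part f"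
  unfolding cycle_rep_def
  by (rule LeastI[of _ x]) (use equiv_Part[OF assms] in \<open>auto simp: equiv_def refl_on_def\<close>)

lemma cycle_rep_cong:
  assumes "bij f" "(x, y) \<in> Part f"
  shows "cycle_rep f x = cycle_rep f y"
proof -
  have "(z, x) \<in> Part f \<longleftrightarrow> (z, y) \<in> Part f" for z
    using equiv_Part[OF assms(1)] assms(2) by (meson equiv_def symE transE)
  then show ?thesis by (simp add: cycle_rep_def)
qed

text \<open>Lets negative exponents be found with forward iterates of \<open>f\<close>
  alone.\<close>

lemma funpow_eq_iff_perm_power:
  assumes "bij f"
  shows "(f ^^ k) x = y \<longleftrightarrow> perm_power f (- int k) y = x"
  using perm_power_uminus_cancel[OF assms, of "int k" x]
    perm_power_uminus_cancel[OF assms, of "- int k" y]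
  by (auto simp: perm_power_of_nat)

lemma rep_exponent_exists:
  assumes "bij f"
  shows "\<exists>k. (f ^^ k) (cycle_rep f x) = x \<or> (f ^^ k) x = cycle_rep f x"
proof -
  obtain j where j: "x = perm_power f j (cycle_rep f x)"
    using cycle_rep_in_Part[OF assms, of x] by (auto simp: Part_def in_cycle_iff)
  show ?thesis
  proof (cases "j \<ge> 0")
    case True
    then have "(f ^^ nat j) (cycle_rep f x) = x"
      using j by (simp add: perm_power_def)
    then show ?thesis by blast
  next
    case False
    then have "(f ^^ nat (- j)) x = cycle_rep f x"
      using j by (auto simp: funpow_eq_iff_perm_power[OF assms])
    then show ?thesis by blast
  qed
qed

text \<open>Hides which exponent the search found. That every other exponent gives the same value is
  shown later, from the isomorphism.\<close>

lemma transfer_eq: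
  assumes "bij f"
  shows "\<exists>j. x = perm_power f j (cycle_rep f x) \<and>
    transfer f g \<theta> x = perm_power g j (\<theta> (cycle_rep f x))"
proof -
  define k where "k = rep_exponent f x"
  have k: "(f ^^ k) (cycle_rep f x) = x \<or> (f ^^ k) x = cycle_rep f x"
    unfolding k_def rep_exponent_def by (rule LeastI_ex) (rule rep_exponent_exists[OF assms])
  show ?thesis
  proof (cases "(f ^^ k) (cycle_rep f x) = x")
    case True
    then show ?thesis
      by (intro exI[of _ "int k"]) (simp add: transfer_def k_def[symmetric] perm_power_of_nat)
  next
    case False
    with k have "perm_power f (- int k) (cycle_rep f x) = x"
      by (simp add: funpow_eq_iff_perm_power[OF assms])
    with False show ?thesis
      by (intro exI[of _ "- int k"])
        (simp add: transfer_def k_def[symmetric] perm_power_minus_of_nat)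
  qed
qed

lemma realizes_transfer:
  assumes "realizes p f" "realizes q g" "decides d (Part f)" "realizes s \<theta>" "bij f" "bij g"
  shows "realizes (transfer_prog p q d s) (transfer f g \<theta>)"
proof -
  have rep: "computes (rep_prog d) [x] (cycle_rep f x)" for x
  proof -
    define F where "F = (\<lambda>y. 1 - of_bool ((y, x) \<in> Part f) :: nat)"
    have zero: "F y = 0 \<longleftrightarrow> (y, x) \<in> Part f" for y by (simp add: F_def)
    have "computes (Comp monus_prog [d, Comp Succ [Zero]]) [y, x] (F y)" for y
      unfolding F_def
      by (rule computes_Comps computes_monus assms(3)[unfolded decides_def, rule_format]
          computes.Succ[of 0, folded One_nat_def] computes.Zero | simp)+
    \<comment> \<open>The search halts because \<open>x\<close> itself is a zero, by
      reflexivity.\<close>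
    then have "computes (rep_prog d) [x] (LEAST y. F y = 0)"
      unfolding rep_prog_def
      by (rule computes_Mu_Least[of _ _ _ x])
        (use equiv_Part[OF \<open>bij f\<close>] in \<open>auto simp: zero equiv_def refl_on_def\<close>)
    then show ?thesis by (simp add: zero cycle_rep_def)
  qed
  have expo: "computes (exponent_prog p d) [x] (rep_exponent f x)" for x
  proof -
    define F where "F = (\<lambda>k. ((x - (f ^^ k) (cycle_rep f x)) + ((f ^^ k) (cycle_rep f x) - x)) *
       ((cycle_rep f x - (f ^^ k) x) + ((f ^^ k) x - cycle_rep f x)))"
    have zero: "F k = 0 \<longleftrightarrow> (f ^^ k) (cycle_rep f x) = x \<or> (f ^^ k) x = cycle_rep f x" for k
      by (auto simp: F_def)
    obtain k where "F k = 0" using rep_exponent_exists[OF \<open>bij f\<close>] zero by blast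
    then have "computes (exponent_prog p d) [x] (LEAST k. F k = 0)"
      unfolding exponent_prog_def
      by (rule computes_Mu_Least[rotated]) (unfold F_def,
        (rule computes_Comps computes_mult computes_dist computes_iterate[OF assms(1)] rep
          computes_Proj | simp)+)
    then show ?thesis by (simp add: zero rep_exponent_def)
  qed
  have s: "computes s [x] (\<theta> x)" for x
    using assms(4) by (simp add: realizes_def)
  have "computes (transfer_prog p q d s) [x]
    (if (x - (f ^^ rep_exponent f x) (cycle_rep f x)) + ((f ^^ rep_exponent f x) (cycle_rep f x) - x) = 0
     then (g ^^ rep_exponent f x) (\<theta> (cycle_rep f x))
     else (inv g ^^ rep_exponent f x) (\<theta> (cycle_rep f x)))" for x
    unfolding transfer_prog_def
    by (rule computes_Comps computes_if_zero computes_dist computes_iterate[OF assms(1)]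
        computes_iterate[OF assms(2)] computes_iterate[OF realizes_inverse[OF assms(2,6)]]
        rep expo s computes_Proj | simp)+
  moreover have "(x - y) + (y - x) = 0 \<longleftrightarrow> y = x" for x y :: nat by auto
  ultimately show ?thesis
    by (simp add: realizes_def transfer_def Let_def del: add_is_0)
qed

lemma conjugates_transfer:
  assumes "bij f" "bij g" "isomorphism \<theta> (Part f) (Part g)" "realizes t (transfer f g \<theta>)"
  shows "conjugates (transfer f g \<theta>) f g"
proof -
  let ?h = "transfer f g \<theta>"
  have "bij \<theta>" and iso: "\<And>x y. (x, y) \<in> Part f \<longleftrightarrow> (\<theta> x, \<theta> y) \<in> Part g"
    using assms(3) by (auto simp: isomorphism_def rec_perms_def)
  \<comment> \<open>Writing \<open>y\<close> as \<open>\<theta> (inv \<theta> y)\<close> lets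
    \<open>iso\<close> cover every point, so the image is the whole cycle.\<close>
  have "\<theta> ` cycle f x = cycle g (\<theta> x)" for x
  proof -
    have "y \<in> \<theta> ` cycle f x \<longleftrightarrow> y \<in> cycle g (\<theta> x)" for y
      using iso[of x "inv \<theta> y"] \<open>bij \<theta>\<close> bij_image_Collect_eq[of \<theta> "\<lambda>y. y \<in> cycle f x"]
      by (simp add: Part_def bij_is_surj surj_f_inv_f)
    then show ?thesis by blast
  qed
  then have card: "card (cycle f x) = card (cycle g (\<theta> x))" for x
    using card_image[of \<theta> "cycle f x"] \<open>bij \<theta>\<close> by (metis bij_is_inj inj_on_subset subset_UNIV)
  \<comment> \<open>Both sides say that \<open>j - k\<close> is divisible by the common cardinality,
    which counts as 0 for infinite cycles.\<close>
  have eq: "perm_power f j x = perm_power f k x \<longleftrightarrow>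
      perm_power g j (\<theta> x) = perm_power g k (\<theta> x)" for j k x
    by (simp add: perm_power_eq_iff assms(1,2) perm_power_fixes_iff card)
  have transfer_perm_power: "?h (perm_power f j x0) = perm_power g j (\<theta> x0)"
    if "x0 = cycle_rep f x" for j x x0
  proof -
    have "(x0, perm_power f j x0) \<in> Part f"
      by (auto simp: Part_def in_cycle_iff)
    then have "cycle_rep f (perm_power f j x0) = cycle_rep f x0"
      using cycle_rep_cong[OF assms(1)] by simp
    also have "\<dots> = x0"
      using cycle_rep_cong[OF assms(1) cycle_rep_in_Part[OF assms(1), of x]] that by simp
    \<comment> \<open>The exponent \<open>i\<close> used by \<open>transfer\<close> may differ from
      \<open>j\<close>; \<open>eq\<close> carries their agreement over to \<open>g\<close>.\<close>
    finally obtain i where "perm_power f j x0 = perm_power f i x0"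
      "?h (perm_power f j x0) = perm_power g i (\<theta> x0)"
      using transfer_eq[OF assms(1), of "perm_power f j x0" g \<theta>] by auto
    then show ?thesis using eq by simp
  qed
  have decomp: "\<exists>j. x = perm_power f j (cycle_rep f x)" for x
    using transfer_eq[OF assms(1)] by blast
  have comm: "?h (f x) = g (?h x)" for x
  proof -
    obtain j where j: "x = perm_power f j (cycle_rep f x)" using decomp by blast
    then have "f x = perm_power f (j + 1) (cycle_rep f x)"
      using perm_power_plus_1[OF assms(1)] by metis
    then have "?h (f x) = perm_power g (j + 1) (\<theta> (cycle_rep f x))"
      by (simp add: transfer_perm_power)
    also have "\<dots> = g (?h x)"
      using transfer_perm_power[OF refl, of j x] j perm_power_plus_1[OF assms(2)] by simp
    finally show ?thesis .
  qed
  have "surj ?h"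
  proof (rule surjI)
    fix y
    \<comment> \<open>The representative whose image lies in the \<open>g\<close>-cycle of
      \<open>y\<close>, so some power of \<open>g\<close> leads from there to
      \<open>y\<close>.\<close>
    define x0 where "x0 = cycle_rep f (inv \<theta> y)"
    have "(\<theta> x0, y) \<in> Part g"
      using iso[of x0 "inv \<theta> y"] cycle_rep_in_Part[OF assms(1), of "inv \<theta> y"] \<open>bij \<theta>\<close>
      by (simp add: x0_def bij_is_surj surj_f_inv_f)
    then obtain j where "y = perm_power g j (\<theta> x0)" by (auto simp: Part_def in_cycle_iff)
    then have "?h (perm_power f j x0) = y" using transfer_perm_power[OF x0_def] by simp
    then show "?h (SOME x. ?h x = y) = y" by (rule someI)
  qed
  moreover have "inj ?h"
  proof (rule injI)
    fix x y assume xy: "?h x = ?h y"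
    obtain j k where j: "x = perm_power f j (cycle_rep f x)"
      "?h x = perm_power g j (\<theta> (cycle_rep f x))"
      and k: "y = perm_power f k (cycle_rep f y)"
      "?h y = perm_power g k (\<theta> (cycle_rep f y))"
      using transfer_eq[OF assms(1), of x] transfer_eq[OF assms(1), of y] by metis
    \<comment> \<open>A common value puts both images in one \<open>g\<close>-cycle;
      \<open>iso\<close> pulls this back, so the representatives coincide and \<open>eq\<close>
      compares the exponents.\<close>
    have "(\<theta> (cycle_rep f x), ?h x) \<in> Part g" "(\<theta> (cycle_rep f y), ?h x) \<in> Part g"
      unfolding Part_def in_cycle_iff split mem_Collect_eq using j(2) k(2) xy by metis+
    then have "(cycle_rep f x, cycle_rep f y) \<in> Part f"
      using equiv_Part[OF assms(2)] iso by (meson equiv_def symE transE)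
    then have "(x, y) \<in> Part f"
      using cycle_rep_in_Part[OF assms(1)] equiv_Part[OF assms(1)] by (meson equiv_def symE transE)
    then have "cycle_rep f x = cycle_rep f y" by (rule cycle_rep_cong[OF assms(1)])
    then show "x = y" using j k xy eq by metis
  qed
  ultimately have "bij ?h" by (simp add: bij_def)
  moreover have "f = inv ?h \<circ> g \<circ> ?h"
    using \<open>inj ?h\<close> by (simp add: fun_eq_iff comm[symmetric])
  ultimately show ?thesis
    using assms(4) by (auto simp: conjugates_def rec_perms_def)
qed

text \<open>\<open>h\<close> intertwines all integer powers of \<open>f\<close> and
  \<open>g\<close>, so it carries cycles into cycles; its injectivity gives the converse.\<close>

lemma isomorphism_if_conjugates:
  assumes "bij f" "bij g" "conjugates h f g"
  shows "isomorphism h (Part f) (Part g)"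
proof -
  have h: "h \<in> rec_perms" "bij h" and f: "f = inv h \<circ> g \<circ> h"
    using assms(3) by (auto simp: conjugates_def rec_perms_def)
  have comm: "h (f x) = g (h x)" for x
    using h(2) by (subst f) (simp add: bij_is_surj surj_f_inv_f)
  have power: "h (perm_power f k x) = perm_power g k (h x)" for k x
  proof (induction k rule: int_induct[where k = 0])
    case (step1 i)
    then show ?case by (simp add: perm_power_plus_1 assms comm)
  next
    case (step2 i)
    have "g (h (perm_power f (i - 1) x)) = g (perm_power g (i - 1) (h x))"
      using step2 perm_power_plus_1[OF assms(1), of "i - 1" x]
        perm_power_plus_1[OF assms(2), of "i - 1" "h x"] by (simp add: comm[symmetric])
    then show ?case using assms(2) by (simp add: bij_is_inj inj_eq)
  qed (simp add: perm_power_0)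
  have "(x, y) \<in> Part f \<longleftrightarrow> (h x, h y) \<in> Part g" for x y
    using h(2) by (auto simp: Part_def in_cycle_iff power[symmetric] bij_is_inj inj_eq)
  with h(1) show ?thesis by (simp add: isomorphism_def)
qed

section \<open>Uniformity in the given programs\<close>

lemma bij_if_Perm: "f \<in> Perm \<Longrightarrow> bij f"
  by (simp add: Perm_def rec_perms_def)

text \<open>\<open>D\<close> turns the given decider and the program of the isomorphism into a
  decider for \<open>Part f\<close>, so that both choices of \<open>\<Delta>\<close> share one
  proof.\<close>

lemma uniformly_computable_conjugation:
  assumes "computable_transformation 4 (\<lambda>ps. D (ps ! 2) (ps ! 3))"
    and "\<And>f g d s \<theta>. isomorphism \<theta> (Part f) (Part g) \<Longrightarrow> decides d (\<Delta> f g) \<Longrightarrow> realizes s \<theta>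
      \<Longrightarrow> decides (D d s) (Part f)"
  shows "uniformly_computable_from \<Delta>
    (\<lambda>f g \<theta>. isomorphism \<theta> (Part f) (Part g)) (\<lambda>f g h. conjugates h f g)"
proof -
  have "computable_transformation 4
    (\<lambda>ps. transfer_prog (ps ! 0) (ps ! 1) (D (ps ! 2) (ps ! 3)) (ps ! 3))"
    unfolding transfer_prog_def exponent_prog_def rep_prog_def inverse_prog_def iterate_prog_def
    by (rule assms(1) computable_transformation_intros | simp)+
  then obtain T where T: "recursive 4 T"
    "\<And>ps. length ps = 4 \<Longrightarrow> T (map goedel ps) =
      goedel (transfer_prog (ps ! 0) (ps ! 1) (D (ps ! 2) (ps ! 3)) (ps ! 3))"
    by (auto simp: computable_transformation_def)
  show ?thesis
    unfolding uniformly_computable_from_def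
  proof (intro exI[of _ T] conjI ballI allI impI)
    fix f g \<theta> p q d s
    assume fg: "f \<in> Perm" "g \<in> Perm" and \<theta>: "isomorphism \<theta> (Part f) (Part g)"
      and prems: "realizes p f \<and> realizes q g \<and> decides d (\<Delta> f g) \<and> realizes s \<theta>"
    let ?t = "transfer_prog p q (D d s) s"
    have t: "realizes ?t (transfer f g \<theta>)"
      using prems fg \<theta> by (intro realizes_transfer assms(2)[of \<theta> f g] bij_if_Perm) auto
    have "conjugates (transfer f g \<theta>) f g"
      using fg \<theta> t by (intro conjugates_transfer[of _ _ _ ?t] bij_if_Perm)
    moreover have "T [goedel p, goedel q, goedel d, goedel s] = goedel ?t"
      using T(2)[of "[p, q, d, s]"] by (simp add: eval_nat_numeral)
    ultimately show "\<exists>b t. conjugates b f g \<and> realizes t b \<and>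
        T [goedel p, goedel q, goedel d, goedel s] = goedel t"
      using t by blast
  qed (rule T(1))
qed

text \<open>A conjugating permutation already is an isomorphism, so its program, at index 3 of the
  input, is returned unchanged.\<close>

lemma uniformly_computable_isomorphism:
  "uniformly_computable_from \<Delta>
    (\<lambda>f g h. conjugates h f g) (\<lambda>f g \<theta>. isomorphism \<theta> (Part f) (Part g))"
  unfolding uniformly_computable_from_def
proof (intro exI[of _ "\<lambda>xs. xs ! 3"] conjI ballI allI impI)
  show "recursive 4 (\<lambda>xs. xs ! 3)" by (simp add: recursive_nth)
next
  fix f g h p q d s
  assume "f \<in> Perm" "g \<in> Perm" "conjugates h f g"
    and prems: "realizes p f \<and> realizes q g \<and> decides d (\<Delta> f g) \<and> realizes s h"
  then have "isomorphism h (Part f) (Part g)"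
    by (intro isomorphism_if_conjugates bij_if_Perm)
  with prems show "\<exists>b t. isomorphism b (Part f) (Part g) \<and> realizes t b \<and>
      [goedel p, goedel q, goedel d, goedel s] ! 3 = goedel t"
    by (intro exI[of _ h] exI[of _ s]) simp
qed

definition pullback_prog :: "recf \<Rightarrow> recf \<Rightarrow> recf" where
  "pullback_prog d s = Comp d [Comp s [Proj 0], Comp s [Proj 1]]"

lemma decides_pullback:
  assumes "isomorphism \<theta> \<Pi> \<Gamma>" "decides d \<Gamma>" "realizes s \<theta>"
  shows "decides (pullback_prog d s) \<Pi>"
  unfolding decides_def
proof (intro allI)
  fix x y
  have "(x, y) \<in> \<Pi> \<longleftrightarrow> (\<theta> x, \<theta> y) \<in> \<Gamma>" using assms(1) by (simp add: isomorphism_def)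
  moreover have "computes (pullback_prog d s) [x, y] (of_bool ((\<theta> x, \<theta> y) \<in> \<Gamma>))"
    unfolding pullback_prog_def
    by (rule computes_Comps computes_Proj assms(2)[unfolded decides_def, rule_format]
        assms(3)[unfolded realizes_def, rule_format] | simp)+
  ultimately show "computes (pullback_prog d s) [x, y] (of_bool ((x, y) \<in> \<Pi>))"
    by simp
qed

theorem theorem2p19:
  "(\<forall>f\<in>Perm. \<forall>g\<in>Perm. effectively_conjugate f g \<longleftrightarrow> isomorphic (Part f) (Part g)) \<and>
   (\<forall>\<Delta> \<in> {\<lambda>f g. Part f, \<lambda>f g. Part g}.
      uniformly_computable_from \<Delta>
        (\<lambda>f g \<theta>. isomorphism \<theta> (Part f) (Part g)) (\<lambda>f g h. conjugates h f g) \<and>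
      uniformly_computable_from \<Delta>
        (\<lambda>f g h. conjugates h f g) (\<lambda>f g \<theta>. isomorphism \<theta> (Part f) (Part g)))"
proof (rule conjI)
  show "\<forall>f\<in>Perm. \<forall>g\<in>Perm. effectively_conjugate f g \<longleftrightarrow> isomorphic (Part f) (Part g)"
  proof (intro ballI iffI)
    fix f g assume fg: "f \<in> Perm" "g \<in> Perm"
    show "isomorphic (Part f) (Part g)" if "effectively_conjugate f g"
      using that fg isomorphism_if_conjugates bij_if_Perm
      unfolding effectively_conjugate_def isomorphic_def by blast
    show "effectively_conjugate f g" if iso: "isomorphic (Part f) (Part g)"
    proof -
      obtain \<theta> where \<theta>: "isomorphism \<theta> (Part f) (Part g)"
        using iso by (auto simp: isomorphic_def)
      \<comment> \<open>Membership in \<open>Perm\<close> supplies the decider; the resulting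
        transfer program makes the conjugation recursive.\<close>
      obtain p q d s where "realizes p f" "realizes q g" "decides d (Part f)" "realizes s \<theta>"
        using fg \<theta> by (auto simp: Perm_def rec_perms_def decidable_def isomorphism_def)
      note conjugates_transfer[OF bij_if_Perm[OF fg(1)] bij_if_Perm[OF fg(2)] \<theta>
          realizes_transfer[OF this bij_if_Perm[OF fg(1)] bij_if_Perm[OF fg(2)]]]
      then show ?thesis unfolding effectively_conjugate_def by blast
    qed
  qed
  \<comment> \<open>Here the given decider serves directly; for \<open>Part g\<close> it is first
    pulled back.\<close>
  have "uniformly_computable_from (\<lambda>f g. Part f)
      (\<lambda>f g \<theta>. isomorphism \<theta> (Part f) (Part g)) (\<lambda>f g h. conjugates h f g)"
    by (rule uniformly_computable_conjugation[where D = "\<lambda>d s. d"])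
      (simp_all add: computable_transformation_nth)
  moreover have "uniformly_computable_from (\<lambda>f g. Part g)
      (\<lambda>f g \<theta>. isomorphism \<theta> (Part f) (Part g)) (\<lambda>f g h. conjugates h f g)"
  proof (rule uniformly_computable_conjugation[where D = pullback_prog])
    show "computable_transformation 4 (\<lambda>ps. pullback_prog (ps ! 2) (ps ! 3))"
      unfolding pullback_prog_def by (rule computable_transformation_intros | simp)+
  qed (rule decides_pullback)
  ultimately show "\<forall>\<Delta> \<in> {\<lambda>f g. Part f, \<lambda>f g. Part g}.
      uniformly_computable_from \<Delta>
        (\<lambda>f g \<theta>. isomorphism \<theta> (Part f) (Part g)) (\<lambda>f g h. conjugates h f g) \<and>
      uniformly_computable_from \<Delta>
        (\<lambda>f g h. conjugates h f g) (\<lambda>f g \<theta>. isomorphism \<theta> (Part f) (Part g))"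
    by (simp add: uniformly_computable_isomorphism)
qed

end
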